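(* Let $\delta>0$. For every admissible choice of the finite covers and of the anchors made during its execution, the RC-algorithm (described in the context) with precision $\delta$ halts after a finite number of iterations, and its output $\mathbf{x}\in X$ satisfies $\rho(\mathbf{x};\mathbf{s})<\delta$.
   Context: Sound ranging problem (SRP). $(X;\rho)$ is a metric space, $B[\mathbf{c};r]=\{\mathbf{x}\in X\mid\rho(\mathbf{x};\mathbf{c})\leq r\}$, $B(\mathbf{c};r)=\{\mathbf{x}\in X\mid\rho(\mathbf{x};\mathbf{c})<r\}$. $I$ is a nonempty index set, $\{\mathbf{r}_i\}_{i\in I}\subseteq X$ is a bounded indexed set of points (sensors), $\mathbf{s}\in X$ (the source) and $t_0\in\mathbb{R}$ are fixed, and $t_i=t_0+\rho(\mathbf{r}_i;\mathbf{s})$ for $i\in I$. A point $\mathbf{s}'\in X$ is a solution of the SRP $(\{\mathbf{r}_i\};\{t_i\})$ if there is $t'\in\mathbb{R}$ with $t_i=t'+\rho(\mathbf{r}_i;\mathbf{s}')$ for all $i\in I$. Standing assumption: $\mathbf{s}$ is the unique solution in $X$. Defect. For $\mathbf{x}\in X$, $\tau_i(\mathbf{x})=t_i-\rho(\mathbf{x};\mathbf{r}_i)$, and $D_\infty(\mathbf{x})=\sup_{i,j\in I}|\tau_i(\mathbf{x})-\tau_j(\mathbf{x})|$. If $I=\{1,\dots,n\}$ or $I=\mathbb{N}$, then also $D_1(\mathbf{x})=\sum_{i\in I}p_i\bigl|\tau_i(\mathbf{x})-\sum_{j\in I}p_j\tau_j(\mathbf{x})\bigr|$, where $\{p_i\}_{i\in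 I}$ is a fixed family with $p_i>0$, $\sum_{i\in I}p_i=1$. $D$ denotes either $D_\infty$ or $D_1$ (the latter only when it is defined), the same choice for all $\mathbf{x}$. SDN property. $A\subseteq X$ has the SDN property if: $\mathbf{s}\in A$ implies that for every $\delta>0$, $\inf_{\mathbf{x}\in A\setminus B(\mathbf{s};\delta)}D(\mathbf{x})>0$ (with $\inf\varnothing=+\infty$). Covershape. A covershape is given by a set $S\subseteq X$ of admissible anchors and an assignment of a set (coverand) $C[\mathbf{x};r]$ to each anchor $\mathbf{x}\in S$ and size $r>0$, with $\mathbf{x}\in C[\mathbf{x};r]\subseteq B[\mathbf{x};r]\cap S$. A covershape is fixed that satisfies: (i) every coverand $C[\mathbf{c};r]$ has a finite cover by coverands $C[\mathbf{c}_i;\frac r2]$ with $\mathbf{c}_i\in C[\mathbf{c};r]$; (ii) for every coverand $C[\mathbf{c};r]$, putting $F_0=C[\mathbf{c};r]$, $F_k=\bigcup_{\mathbf{x}\in F_{k-1}}C[\mathbf{x};\frac{r}{2^k}]$ for $k\geq1$, the set $F_\infty=\bigcup_{k\geq0}F_k$ has the SDN property. Moreover, (iii) a coverand $C[\mathbf{c};r]$ with $\mathbf{s}\in C[\mathbf{c};r]$ is given (known). RC-algorithm with precision $\delta>0$. Coverands are recorded together with their anchors and sizes. Step 0. Let $k:=1$, $\mathfrak{C}_0:=\{C[\mathbf{c};r]\}$ (the given coverand), $r_k:=r/2^k$ for $k\ge 0$. Step 1. Let $\mathfrak{C}_k:=\varnothing$. For each coverand $C=C[\mathbf{y};r_{k-1}]\in\mathfrak{C}_{k-1}$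 take (by (i)) any finite cover of $C$ by coverands $C[\mathbf{z};r_k]$ with $\mathbf{z}\in C$; for each coverand $C[\mathbf{z};r_k]$ of this cover, add it to $\mathfrak{C}_k$ if $D(\mathbf{z})\leq 2r_k$. Step 2. Let $\mathbf{c}_k$ be the anchor of an arbitrarily chosen coverand from $\mathfrak{C}_k$. Step 3. Let $d_k:=r_k+\max_{C[\mathbf{c}';r_k]\in\mathfrak{C}_k}\rho(\mathbf{c}_k;\mathbf{c}')$. If $d_k<\delta$, then output $\mathbf{x}:=\mathbf{c}_k$ and halt; otherwise let $k:=k+1$ and go to Step 1. *)

theory Defs
  imports "HOL-Analysis.Analysis"
begin

definition arrival_time :: "('i \<Rightarrow> 'a::metric_space) \<Rightarrow> 'a \<Rightarrow> real \<Rightarrow> 'i \<Rightarrow> real" where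
  "arrival_time sens s t0 i = t0 + dist (sens i) s"

definition srp_solution :: "'i set \<Rightarrow> ('i \<Rightarrow> 'a::metric_space) \<Rightarrow> ('i \<Rightarrow> real) \<Rightarrow> 'a \<Rightarrow> bool" where
  "srp_solution I sens t s' \<longleftrightarrow> (\<exists>t'. \<forall>i\<in>I. t i = t' + dist (sens i) s')"

definition tau :: "('i \<Rightarrow> 'a::metric_space) \<Rightarrow> ('i \<Rightarrow> real) \<Rightarrow> 'i \<Rightarrow> 'a \<Rightarrow> real" where
  "tau sens t i x = t i - dist x (sens i)"

text \<open>The supremum is taken in the reals. It is a genuine one because the index set is nonempty
  and the sensors are bounded.\<close>

definition defect_inf :: "'i set \<Rightarrow> ('i \<Rightarrow> 'a::metric_space) \<Rightarrow> ('i \<Rightarrow> real) \<Rightarrow> 'a \<Rightarrow> real" where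
  "defect_inf I sens t x = (SUP (i, j)\<in>I \<times> I. \<bar>tau sens t i x - tau sens t j x\<bar>)"

definition defect_one ::
    "'i set \<Rightarrow> ('i \<Rightarrow> real) \<Rightarrow> ('i \<Rightarrow> 'a::metric_space) \<Rightarrow> ('i \<Rightarrow> real) \<Rightarrow> 'a \<Rightarrow> real" where
  "defect_one I p sens t x =
     (\<Sum>\<^sub>\<infinity>i\<in>I. p i * \<bar>tau sens t i x - (\<Sum>\<^sub>\<infinity>j\<in>I. p j * tau sens t j x)\<bar>)"

text \<open>The second defect is meant for the index sets $\{1,\dots,n\}$ and $\mathbb{N}$. As the index
  type is arbitrary here, this is expressed by countability. With bounded sensors all series
  involved converge absolutely, so no enumeration has to be fixed.\<close>

definition is_defect ::
    "'i set \<Rightarrow> ('i \<Rightarrow> 'a::metric_space) \<Rightarrow> ('i \<Rightarrow> real) \<Rightarrow> ('a \<Rightarrow> real) \<Rightarrow> bool" where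
  "is_defect I sens t D \<longleftrightarrow>
     D = defect_inf I sens t \<or>
     countable I \<and>
       (\<exists>p. (\<forall>i\<in>I. p i > 0) \<and> (p has_sum 1) I \<and> D = defect_one I p sens t)"

text \<open>The infimum is taken in the extended reals, so that over the empty set it is \<open>\<infinity>\<close>.\<close>

definition SDN :: "('a::metric_space \<Rightarrow> real) \<Rightarrow> 'a \<Rightarrow> 'a set \<Rightarrow> bool" where
  "SDN D s A \<longleftrightarrow> (s \<in> A \<longrightarrow> (\<forall>\<delta>>0. (INF x\<in>A - ball s \<delta>. ereal (D x)) > 0))"

text \<open>A coverand is determined by its anchor and its size. The values of \<open>C\<close> at
  anchors outside \<open>S\<close> or at nonpositive sizes are irrelevant.\<close>

definition covershape :: "'a::metric_space set \<Rightarrow> ('a \<Rightarrow> real \<Rightarrow> 'a set) \<Rightarrow> bool" where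
  "covershape S C \<longleftrightarrow> (\<forall>x\<in>S. \<forall>q>0. x \<in> C x q \<and> C x q \<subseteq> cball x q \<inter> S)"

definition finite_cover :: "('a \<Rightarrow> real \<Rightarrow> 'a set) \<Rightarrow> 'a set \<Rightarrow> real \<Rightarrow> 'a set \<Rightarrow> bool" where
  "finite_cover C A q Z \<longleftrightarrow> finite Z \<and> Z \<subseteq> A \<and> A \<subseteq> (\<Union>z\<in>Z. C z q)"

primrec refinement :: "('a \<Rightarrow> real \<Rightarrow> 'a set) \<Rightarrow> 'a \<Rightarrow> real \<Rightarrow> nat \<Rightarrow> 'a set" where
  "refinement C c q 0 = C c q"
| "refinement C c q (Suc k) = (\<Union>x\<in>refinement C c q k. C x (q / 2 ^ Suc k))"

text \<open>The RC-algorithm is a nondeterministic transition system. Finite families of coverands are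
  sets of pairs (anchor, size). In \<open>At_Step1 k K\<close> the set \<open>K\<close> is the
  family number \<open>k - 1\<close>; in \<open>At_Step2 k K\<close> and \<open>At_Step3 k K a\<close> it is
  the family number \<open>k\<close>, and \<open>a\<close> is the chosen anchor. The steps are
  kept separate so that a choice of covers leading to an empty family shows up as a reachable
  stuck state (nothing can be chosen in step 2).\<close>

datatype 'a rc_state =
    At_Step1 nat "('a \<times> real) set"
  | At_Step2 nat "('a \<times> real) set"
  | At_Step3 nat "('a \<times> real) set" 'a
  | Halted 'a

definition rc_init :: "'a \<Rightarrow> real \<Rightarrow> 'a rc_state" where
  "rc_init c r = At_Step1 1 {(c, r)}"

inductive rc_step ::
    "('a::metric_space \<Rightarrow> real) \<Rightarrow> ('a \<Rightarrow> real \<Rightarrow> 'a set) \<Rightarrow> real \<Rightarrow> real \<Rightarrow> 'a rc_state \<Rightarrow> 'a rc_state \<Rightarrow> bool"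
  for D C r \<delta>
where
  step1: "(\<And>y q. (y, q) \<in> K \<Longrightarrow> finite_cover C (C y q) (r / 2 ^ k) (Z (y, q)))
     \<Longrightarrow> rc_step D C r \<delta> (At_Step1 k K)
           (At_Step2 k {(z, r / 2 ^ k) | z. (\<exists>Y\<in>K. z \<in> Z Y) \<and> D z \<le> 2 * (r / 2 ^ k)})"
| step2: "(a, q) \<in> K \<Longrightarrow> rc_step D C r \<delta> (At_Step2 k K) (At_Step3 k K a)"
| step3_halt: "r / 2 ^ k + (MAX (c', q)\<in>K. dist a c') < \<delta>
     \<Longrightarrow> rc_step D C r \<delta> (At_Step3 k K a) (Halted a)"
| step3_next: "\<not> r / 2 ^ k + (MAX (c', q)\<in>K. dist a c') < \<delta>
     \<Longrightarrow> rc_step D C r \<delta> (At_Step3 k K a) (At_Step1 (Suc k) K)"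

end

theory Submission
  imports Defs
begin

text \<open>By the triangle inequality every \<open>\<tau>\<^sub>i(x)\<close> lies within \<open>\<rho>(x; s)\<close> of \<open>t\<^sub>0\<close>, hence
  \<open>D(x) \<le> 2 \<rho>(x; s)\<close>. A coverand that contains the source is therefore never discarded, which
  keeps the families nonempty and bounds the distance of any chosen anchor from the source
  by \<open>d\<^sub>k\<close>. All anchors lie in \<open>F\<^sub>\<infinity>\<close> and those of family \<open>k\<close> have \<open>D \<le> 2 r\<^sub>k\<close>, so by the SDN
  property they eventually all lie in a small ball around the source, which forces \<open>d\<^sub>k < \<delta>\<close>.\<close>

section \<open>The defect compared with the distance to the source\<close>

lemma tau_arrival_time_bound:
  "\<bar>tau sens (arrival_time sens s t0) i x - t0\<bar> \<le> dist x s"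
proof -
  have "dist (sens i) s \<le> dist x (sens i) + dist x s"
    using dist_triangle3[of "sens i" s x] by (simp add: dist_commute)
  moreover have "dist x (sens i) \<le> dist x s + dist (sens i) s"
    using dist_triangle2[of x "sens i" s] by (simp add: dist_commute)
  ultimately show ?thesis
    unfolding tau_def arrival_time_def by linarith
qed

lemma defect_inf_le:
  assumes "I \<noteq> {}"
  shows "defect_inf I sens (arrival_time sens s t0) x \<le> 2 * dist x s"
  unfolding defect_inf_def
proof (rule cSUP_least)
  show "I \<times> I \<noteq> {}"
    using assms by simp
next
  fix ij :: "'a \<times> 'a"
  obtain i j where ij: "ij = (i, j)"
    by fastforce
  show "(case ij of (i, j) \<Rightarrow> \<bar>tau sens (arrival_time sens s t0) i x
      - tau sens (arrival_time sens s t0) j x\<bar>) \<le> 2 * dist x s"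
    using tau_arrival_time_bound[of sens s t0 i x] tau_arrival_time_bound[of sens s t0 j x]
    by (simp add: ij)
qed

text \<open>Serves both sums in \<open>defect_one\<close>: the inner mean with centre
  \<open>t0\<close>, the outer sum with centre 0. Summability must come first, since
  \<open>infsum\<close> of a non-summable family defaults to 0.\<close>

lemma weighted_infsum_bound:
  fixes p f :: "'i \<Rightarrow> real"
  assumes "\<And>i. i \<in> I \<Longrightarrow> p i \<ge> 0" and "(p has_sum 1) I"
    and "\<And>i. i \<in> I \<Longrightarrow> \<bar>f i - m\<bar> \<le> b"
  shows "\<bar>(\<Sum>\<^sub>\<infinity>i\<in>I. p i * f i) - m\<bar> \<le> b"
proof -
  have sum_const: "((\<lambda>i. p i * a) has_sum a) I" for a
    using has_sum_cmult_left[OF assms(2), of a] by simp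
  have bounds: "p i * (m - b) \<le> p i * f i" "p i * f i \<le> p i * (m + b)" if "i \<in> I" for i
    using assms(1,3)[OF that] by (intro mult_left_mono; linarith)+
  \<comment> \<open>Subtracting \<open>p i * (m - b)\<close> makes the terms nonnegative and at most
    \<open>p i * (2 * b)\<close>, so the comparison test applies; the shift is undone
    afterwards.\<close>
  have "(\<lambda>i. p i * (2 * b)) summable_on I"
    by (rule has_sum_imp_summable[OF sum_const])
  then have "(\<lambda>i. p i * f i - p i * (m - b)) summable_on I"
    by (rule summable_on_comparison_test) (use bounds in \<open>auto simp: algebra_simps\<close>)
  then have "(\<lambda>i. (p i * f i - p i * (m - b)) + p i * (m - b)) summable_on I"
    by (intro summable_on_add has_sum_imp_summable[OF sum_const])
  then have "((\<lambda>i. p i * f i) has_sum (\<Sum>\<^sub>\<infinity>i\<in>I. p i * f i)) I"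
    by simp
  then have "m - b \<le> (\<Sum>\<^sub>\<infinity>i\<in>I. p i * f i)" "(\<Sum>\<^sub>\<infinity>i\<in>I. p i * f i) \<le> m + b"
    using has_sum_mono[OF sum_const _ bounds(1)] has_sum_mono[OF _ sum_const bounds(2)] by auto
  then show ?thesis
    by linarith
qed

lemma defect_one_le:
  assumes "\<And>i. i \<in> I \<Longrightarrow> p i > 0" and "(p has_sum 1) I"
  shows "defect_one I p sens (arrival_time sens s t0) x \<le> 2 * dist x s"
proof -
  let ?\<tau> = "\<lambda>i. tau sens (arrival_time sens s t0) i x"
  define m where "m = (\<Sum>\<^sub>\<infinity>j\<in>I. p j * ?\<tau> j)"
  have pos: "\<And>i. i \<in> I \<Longrightarrow> p i \<ge> 0"
    using assms(1) by (simp add: less_imp_le)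
  have m: "\<bar>m - t0\<bar> \<le> dist x s"
    unfolding m_def by (rule weighted_infsum_bound[OF pos assms(2) tau_arrival_time_bound])
  \<comment> \<open>Both \<open>?\<tau> i\<close> and the mean \<open>m\<close> are within
    \<open>dist x s\<close> of \<open>t0\<close>. The \<open>- 0\<close> fits the weighted bound
    with centre 0.\<close>
  have dev: "\<bar>\<bar>?\<tau> i - m\<bar> - 0\<bar> \<le> 2 * dist x s" for i
    using tau_arrival_time_bound[of sens s t0 i x] m by linarith
  have "\<bar>(\<Sum>\<^sub>\<infinity>i\<in>I. p i * \<bar>?\<tau> i - m\<bar>) - 0\<bar> \<le> 2 * dist x s"
    by (rule weighted_infsum_bound[OF pos assms(2) dev])
  then show ?thesis
    unfolding defect_one_def m_def by linarith
qed

lemma is_defect_le: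
  assumes "I \<noteq> {}" and "is_defect I sens (arrival_time sens s t0) D"
  shows "D x \<le> 2 * dist x s"
  using assms defect_inf_le[of I sens s t0 x] defect_one_le[of I _ sens s t0 x]
  unfolding is_defect_def by auto

lemma SDN_lower_bound:
  assumes "SDN D s A" and "s \<in> A" and "\<epsilon> > 0"
  obtains e where "e > 0" and "\<And>x. x \<in> A \<Longrightarrow> D x \<le> e \<Longrightarrow> dist s x < \<epsilon>"
proof -
  have "0 < (INF x\<in>A - ball s \<epsilon>. ereal (D x))"
    using assms unfolding SDN_def by blast
  \<comment> \<open>Density gives a real threshold even if the infimum is \<infinity>, as it is over
    the empty set.\<close>
  then obtain e where e: "0 < ereal e" "ereal e < (INF x\<in>A - ball s \<epsilon>. ereal (D x))"
    using ereal_dense2 by blast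
  show thesis
  proof
    show "e > 0"
      using e(1) by simp
    show "dist s x < \<epsilon>" if "x \<in> A" "D x \<le> e" for x
    proof (rule ccontr)
      assume "\<not> dist s x < \<epsilon>"
      then have "ereal e < ereal (D x)"
        using that(1) by (intro less_INF_D[OF e(2)]) simp
      then show False
        using that(2) by simp
    qed
  qed
qed

section \<open>Invariant and partial correctness of the RC-algorithm\<close>

inductive_cases rc_step_At_Step1E: "rc_step D C r \<delta> (At_Step1 k K) st"
inductive_cases rc_step_At_Step2E: "rc_step D C r \<delta> (At_Step2 k K) st"
inductive_cases rc_step_At_Step3E: "rc_step D C r \<delta> (At_Step3 k K a) st"
inductive_cases rc_step_HaltedE: "rc_step D C r \<delta> (Halted x) st"

text \<open>Abstracts from sensors and times: the defect enters only through
  \<open>defect_le\<close> and the SDN property, so both kinds of defect are treated at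
  once.\<close>

locale rc_problem =
  fixes s :: "'a::metric_space" and D :: "'a \<Rightarrow> real" and S :: "'a set"
    and C :: "'a \<Rightarrow> real \<Rightarrow> 'a set" and c :: 'a and r \<delta> :: real
  assumes defect_le: "D x \<le> 2 * dist x s"
    and covershape: "covershape S C"
    and cover_ex: "x \<in> S \<Longrightarrow> q > 0 \<Longrightarrow> \<exists>Z. finite_cover C (C x q) (q / 2) Z"
    and SDN: "SDN D s (\<Union>k. refinement C c r k)"
    and c_in: "c \<in> S" and r_pos: "r > 0" and s_in: "s \<in> C c r" and \<delta>_pos: "\<delta> > 0"
begin

text \<open>The containment in \<open>refinement\<close> concerns whole coverands, because the
  anchors of the next family are taken from their points.\<close>

definition family :: "nat \<Rightarrow> ('a \<times> real) set \<Rightarrow> bool" where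
  "family k K \<longleftrightarrow> finite K \<and>
     (\<forall>(y, q)\<in>K. q = r / 2 ^ k \<and> y \<in> S \<and> C y q \<subseteq> refinement C c r k) \<and>
     (\<exists>(y, q)\<in>K. s \<in> C y q)"

definition filtered :: "nat \<Rightarrow> ('a \<times> real) set \<Rightarrow> bool" where
  "filtered k K \<longleftrightarrow> (\<forall>(y, q)\<in>K. D y \<le> 2 * (r / 2 ^ k))"

text \<open>Before step 1 the stored family still has number \<open>k - 1\<close>;
  \<open>k > 0\<close> keeps the truncated subtraction exact.\<close>

primrec rc_inv :: "'a rc_state \<Rightarrow> bool" where
  "rc_inv (At_Step1 k K) \<longleftrightarrow> k > 0 \<and> family (k - 1) K"
| "rc_inv (At_Step2 k K) \<longleftrightarrow> family k K \<and> filtered k K"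
| "rc_inv (At_Step3 k K a) \<longleftrightarrow> family k K \<and> filtered k K \<and> (\<exists>q. (a, q) \<in> K)"
| "rc_inv (Halted x) \<longleftrightarrow> dist x s < \<delta>"

lemma anchor_mem: "x \<in> S \<Longrightarrow> q > 0 \<Longrightarrow> x \<in> C x q"
  and coverand_subset: "x \<in> S \<Longrightarrow> q > 0 \<Longrightarrow> C x q \<subseteq> S"
  and coverand_dist: "x \<in> S \<Longrightarrow> q > 0 \<Longrightarrow> y \<in> C x q \<Longrightarrow> dist x y \<le> q"
  using covershape unfolding covershape_def by (auto simp: subset_iff)

lemma familyD:
  assumes "family k K" and "(y, q) \<in> K"
  shows "q = r / 2 ^ k" and "y \<in> S" and "C y q \<subseteq> refinement C c r k" and "q > 0"
  using assms r_pos unfolding family_def by auto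

lemma family_source:
  assumes "family k K"
  obtains y where "(y, r / 2 ^ k) \<in> K" and "s \<in> C y (r / 2 ^ k)"
  using assms unfolding family_def by fast

lemma rc_inv_init: "rc_inv (rc_init c r)"
  using c_in s_in by (simp add: rc_init_def family_def)

lemma family_Suc:
  assumes fam: "family k K"
    and cover: "\<And>y q. (y, q) \<in> K \<Longrightarrow> finite_cover C (C y q) (r / 2 ^ Suc k) (Z (y, q))"
  defines "K' \<equiv> {(z, r / 2 ^ Suc k) | z. (\<exists>Y\<in>K. z \<in> Z Y) \<and> D z \<le> 2 * (r / 2 ^ Suc k)}"
  shows "family (Suc k) K'"
  unfolding family_def
proof (intro conjI)
  have "finite K" "\<And>Y. Y \<in> K \<Longrightarrow> finite (Z Y)"
    using fam cover unfolding family_def finite_cover_def by auto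
  moreover have "K' \<subseteq> (\<lambda>z. (z, r / 2 ^ Suc k)) ` (\<Union>Y\<in>K. Z Y)"
    unfolding K'_def by blast
  ultimately show "finite K'"
    by (meson finite_UN_I finite_imageI finite_subset)
  show "\<forall>(z, q)\<in>K'. q = r / 2 ^ Suc k \<and> z \<in> S \<and> C z q \<subseteq> refinement C c r (Suc k)"
  proof (clarify)
    fix z q
    assume "(z, q) \<in> K'"
    then obtain y p where yp: "(y, p) \<in> K" "z \<in> Z (y, p)" and q: "q = r / 2 ^ Suc k"
      unfolding K'_def by auto
    then have "z \<in> C y p"
      using cover[OF yp(1)] unfolding finite_cover_def by blast
    \<comment> \<open>The new anchor \<open>z\<close> lies in the parent coverand, hence in level
      \<open>k\<close> of the refinement, so \<open>C z q\<close> is one of the sets united to form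
      level \<open>Suc k\<close>.\<close>
    then show "q = r / 2 ^ Suc k \<and> z \<in> S \<and> C z q \<subseteq> refinement C c r (Suc k)"
      using familyD[OF fam yp(1)] coverand_subset[of y p] q by auto
  qed
  obtain y where y: "(y, r / 2 ^ k) \<in> K" "s \<in> C y (r / 2 ^ k)"
    using family_source[OF fam] .
  \<comment> \<open>Some member of the cover inherits the source; it remains to see that its anchor
    passes the filter.\<close>
  then obtain z where z: "z \<in> Z (y, r / 2 ^ k)" "s \<in> C z (r / 2 ^ Suc k)"
    using cover[OF y(1)] unfolding finite_cover_def by blast
  have "z \<in> C y (r / 2 ^ k)"
    using cover[OF y(1)] z(1) unfolding finite_cover_def by blast
  then have "z \<in> S"
    using familyD[OF fam y(1)] coverand_subset by blast
  then have "dist z s \<le> r / 2 ^ Suc k"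
    using z(2) r_pos by (intro coverand_dist) auto
  then have "D z \<le> 2 * (r / 2 ^ Suc k)"
    using defect_le[of z] by linarith
  then have "(z, r / 2 ^ Suc k) \<in> K'"
    unfolding K'_def using y(1) z(1) by blast
  then show "\<exists>(z, q)\<in>K'. s \<in> C z q"
    using z(2) by blast
qed

text \<open>Why the halting test certifies the precision: go from \<open>a\<close> to the source
  through the anchor \<open>y\<close> of a coverand that contains it.\<close>

lemma anchor_dist_source:
  assumes fam: "family k K"
  shows "dist a s \<le> r / 2 ^ k + (MAX (c', q)\<in>K. dist a c')"
proof -
  obtain y where y: "(y, r / 2 ^ k) \<in> K" "s \<in> C y (r / 2 ^ k)"
    using family_source[OF fam] .
  have "dist y s \<le> r / 2 ^ k"
    using coverand_dist familyD[OF fam y(1)] y(2) by blast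
  moreover have "dist a y \<le> (MAX (c', q)\<in>K. dist a c')"
    using fam y(1) unfolding family_def by (intro Max_ge) (auto intro: rev_image_eqI)
  ultimately show ?thesis
    using dist_triangle[of a s y] by linarith
qed

lemma rc_inv_step:
  assumes "rc_step D C r \<delta> st st'" and "rc_inv st"
  shows "rc_inv st'"
  using assms
proof cases
  case (step1 K k Z)
  then obtain j where k: "k = Suc j"
    using assms(2) by (cases k) auto
  have "family j K"
    using assms(2) step1(1) k by simp
  then show ?thesis
    using family_Suc[of j K Z] step1 k by (auto simp: filtered_def)
next
  case (step2 a q K k)
  then show ?thesis
    using assms(2) by auto
next
  case (step3_halt k a K)
  then show ?thesis
    using assms(2) anchor_dist_source[of k K a] by simp
next
  case (step3_next k a K)
  then show ?thesis
    using assms(2) by simp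
qed

lemma rc_inv_reachable:
  assumes "(rc_step D C r \<delta>)\<^sup>*\<^sup>* (rc_init c r) st"
  shows "rc_inv st"
  using assms by induction (auto intro: rc_inv_init rc_inv_step)

text \<open>Step 1 can proceed since finite covers exist, step 2 since the family contains a
  coverand around the source, and step 3 since its two tests are complementary.\<close>

lemma rc_stuck_halted:
  assumes "rc_inv st" and stuck: "\<nexists>st'. rc_step D C r \<delta> st st'"
  shows "\<exists>x. st = Halted x \<and> dist x s < \<delta>"
proof (cases st)
  case (At_Step1 k K)
  with assms obtain j where k: "k = Suc j" and fam: "family j K"
    by (cases k) auto
  have "\<forall>Y\<in>K. \<exists>Z. finite_cover C (C (fst Y) (snd Y)) (r / 2 ^ k) Z"
  proof
    fix Y
    assume "Y \<in> K"
    then have Y: "(fst Y, snd Y) \<in> K"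
      by simp
    \<comment> \<open>The stored coverands have size \<open>r / 2 ^ j\<close> with
      \<open>k = Suc j\<close>, so halving it gives the size required at round
      \<open>k\<close>.\<close>
    have "snd Y / 2 = r / 2 ^ k"
      unfolding familyD(1)[OF fam Y] k by simp
    then show "\<exists>Z. finite_cover C (C (fst Y) (snd Y)) (r / 2 ^ k) Z"
      using cover_ex[OF familyD(2,4)[OF fam Y]] by metis
  qed
  then obtain Z where Z: "\<forall>Y\<in>K. finite_cover C (C (fst Y) (snd Y)) (r / 2 ^ k) (Z Y)"
    by (auto dest: bchoice)
  have "finite_cover C (C y q) (r / 2 ^ k) (Z (y, q))" if "(y, q) \<in> K" for y q
    using bspec[OF Z that] by simp
  then show ?thesis
    using stuck rc_step.step1[of K C r k Z D \<delta>] unfolding At_Step1 by blast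
next
  case (At_Step2 k K)
  then show ?thesis
    using assms by (auto elim: family_source intro: rc_step.step2)
next
  case (At_Step3 k K a)
  then show ?thesis
    using stuck rc_step.step3_halt[of r k a K \<delta> D C] rc_step.step3_next[of r k a K \<delta> D C]
    by blast
next
  case (Halted x)
  then show ?thesis
    using assms(1) by simp
qed

section \<open>Termination\<close>

text \<open>The bound \<open>N\<close> comes from the SDN threshold and the sizes alone, so it is
  uniform in all covers and anchors chosen.\<close>

lemma eventually_halts:
  obtains N where "\<And>k K a q. k \<ge> N \<Longrightarrow> family k K \<Longrightarrow> filtered k K \<Longrightarrow> (a, q) \<in> K \<Longrightarrow>
    r / 2 ^ k + (MAX (c', q)\<in>K. dist a c') < \<delta>"
proof -
  let ?F = "\<Union>k. refinement C c r k"
  have "s \<in> refinement C c r 0"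
    using s_in by simp
  then have "s \<in> ?F"
    by blast
  then obtain e where e: "e > 0" "\<And>x. x \<in> ?F \<Longrightarrow> D x \<le> e \<Longrightarrow> dist s x < \<delta> / 4"
    using SDN_lower_bound[OF SDN, of "\<delta> / 4"] \<delta>_pos by auto
  \<comment> \<open>For \<open>r / 2 ^ k < b\<close>, the part \<open>e / 2\<close> turns the filter
    bound into \<open>D y \<le> e\<close>; the part \<open>\<delta> / 4\<close> leaves room for the
    maximum, which is at most \<open>\<delta> / 2\<close> once all anchors are within
    \<open>\<delta> / 4\<close> of the source.\<close>
  define b where "b = min (e / 2) (\<delta> / 4)"
  have "b > 0"
    using e(1) \<delta>_pos by (simp add: b_def)
  then obtain N where N: "(1 / 2) ^ N < b / r"
    using real_arch_pow_inv[of "b / r" "1 / 2"] r_pos by auto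
  show thesis
  proof
    fix k K a q
    assume k: "k \<ge> N" and fam: "family k K" and filt: "filtered k K" and a: "(a, q) \<in> K"
    have "(1 / 2 :: real) ^ k \<le> (1 / 2) ^ N"
      using k by (intro power_decreasing) auto
    with N have "(1 / 2) ^ k < b / r"
      by linarith
    then have rk: "r / 2 ^ k < b"
      using r_pos by (simp add: field_simps)
    have near: "dist s y < \<delta> / 4" if y: "(y, p) \<in> K" for y p
    proof (rule e(2))
      show "y \<in> ?F"
        using anchor_mem familyD[OF fam y] by blast
      have "D y \<le> 2 * (r / 2 ^ k)"
        using filt y unfolding filtered_def by blast
      then show "D y \<le> e"
        using rk b_def by linarith
    qed
    have "(MAX (c', q)\<in>K. dist a c') \<le> \<delta> / 2"
    proof (rule Max.boundedI)
      show "finite ((\<lambda>(c', q). dist a c') ` K)" "(\<lambda>(c', q). dist a c') ` K \<noteq> {}"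
        using fam a unfolding family_def by auto
      fix d
      assume "d \<in> (\<lambda>(c', q). dist a c') ` K"
      then obtain y p where y: "(y, p) \<in> K" and d: "d = dist a y"
        by auto
      then show "d \<le> \<delta> / 2"
        using near[OF y] near[OF a] dist_triangle3[of a y s] by linarith
    qed
    then show "r / 2 ^ k + (MAX (c', q)\<in>K. dist a c') < \<delta>"
      using rk b_def \<delta>_pos by linarith
  qed
qed

lemma no_infinite_run:
  assumes init: "\<sigma> 0 = rc_init c r"
    and step: "\<And>n. rc_step D C r \<delta> (\<sigma> n) (\<sigma> (Suc n))"
  shows False
proof -
  have inv: "rc_inv (\<sigma> n)" for n
    by (induction n) (auto simp: init intro: rc_inv_init rc_inv_step[OF step])
  have round: "\<exists>K a. \<sigma> (Suc (Suc n)) = At_Step3 k K a" if st: "\<sigma> n = At_Step1 k K" for n k K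
  proof -
    obtain K' where "\<sigma> (Suc n) = At_Step2 k K'"
      using step[of n] unfolding st by (elim rc_step_At_Step1E) blast
    then show ?thesis
      using step[of "Suc n"] by (auto elim: rc_step_At_Step2E)
  qed
  \<comment> \<open>A round takes three transitions, and the counter starts at 1. An infinite run
    never halts, as \<open>Halted\<close> has no successor, so step 3 always leads to another
    round.\<close>
  have rounds: "\<exists>K. \<sigma> (3 * n) = At_Step1 (Suc n) K" for n
  proof (induction n)
    case 0
    show ?case
      by (simp add: init rc_init_def)
  next
    case (Suc n)
    then obtain K a where st: "\<sigma> (Suc (Suc (3 * n))) = At_Step3 (Suc n) K a"
      using round by blast
    have eq: "3 * Suc n = Suc (Suc (Suc (3 * n)))"
      by simp
    have "\<sigma> (3 * Suc n) \<noteq> Halted a"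
      using step[of "3 * Suc n"] by (auto elim: rc_step_HaltedE)
    moreover have "rc_step D C r \<delta> (At_Step3 (Suc n) K a) (\<sigma> (3 * Suc n))"
      using step[of "Suc (Suc (3 * n))"] by (simp only: st eq)
    ultimately show ?case
      by (blast elim: rc_step_At_Step3E)
  qed
  obtain N where N: "\<And>k K a q. k \<ge> N \<Longrightarrow> family k K \<Longrightarrow> filtered k K \<Longrightarrow> (a, q) \<in> K \<Longrightarrow>
      r / 2 ^ k + (MAX (c', q)\<in>K. dist a c') < \<delta>"
    using eventually_halts by blast
  let ?n = "Suc (Suc (3 * N))"
  obtain K a where st: "\<sigma> ?n = At_Step3 (Suc N) K a"
    using rounds round by blast
  then have "r / 2 ^ Suc N + (MAX (c', q)\<in>K. dist a c') < \<delta>"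
    using inv[of ?n] N[of "Suc N" K a] by auto
  \<comment> \<open>The test now succeeds, which excludes \<open>step3_next\<close>.\<close>
  then have "\<sigma> (Suc ?n) = Halted a"
    using step[of ?n] unfolding st by (blast elim: rc_step_At_Step3E)
  then show False
    using step[of "Suc ?n"] by (auto elim: rc_step_HaltedE)
qed

end

text \<open>Total correctness under nondeterminism has two halves: no sequence of choices runs
  forever, and every reachable state without successor is a correct output, which also excludes
  getting stuck at an empty family.\<close>

theorem proposition6:
  fixes I :: "'i set" and sens :: "'i \<Rightarrow> 'a::metric_space" and s :: 'a and t0 :: real
    and t :: "'i \<Rightarrow> real" and D :: "'a \<Rightarrow> real"
    and S :: "'a set" and C :: "'a \<Rightarrow> real \<Rightarrow> 'a set"
    and c :: 'a and r \<delta> :: real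
  assumes "I \<noteq> {}" and "bounded (sens ` I)"
    and "t = arrival_time sens s t0"
    and "\<And>s'. srp_solution I sens t s' \<Longrightarrow> s' = s"
    and "is_defect I sens t D"
    and "covershape S C"
    and "\<And>x q. x \<in> S \<Longrightarrow> q > 0 \<Longrightarrow> \<exists>Z. finite_cover C (C x q) (q / 2) Z"
    and "\<And>x q. x \<in> S \<Longrightarrow> q > 0 \<Longrightarrow> SDN D s (\<Union>k. refinement C x q k)"
    and "c \<in> S" and "r > 0" and "s \<in> C c r"
    and "\<delta> > 0"
  shows "(\<nexists>\<sigma>. \<sigma> 0 = rc_init c r \<and> (\<forall>n. rc_step D C r \<delta> (\<sigma> n) (\<sigma> (Suc n)))) \<and>
    (\<forall>st. (rc_step D C r \<delta>)\<^sup>*\<^sup>* (rc_init c r) st \<and> (\<nexists>st'. rc_step D C r \<delta> st st') \<longrightarrow>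
      (\<exists>x. st = Halted x \<and> dist x s < \<delta>))"
proof -
  interpret rc_problem s D S C c r \<delta>
  proof
    show "D x \<le> 2 * dist x s" for x
      using is_defect_le[OF assms(1) assms(5)[unfolded assms(3)]] .
    show "SDN D s (\<Union>k. refinement C c r k)"
      by (rule assms(8)[OF assms(9,10)])
  qed (fact assms)+
  show ?thesis
    using no_infinite_run rc_inv_reachable rc_stuck_halted by blast
qed

end
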